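(* $(\mathcal{C}_L^N,\odot)$ and $(\mathcal{C}_U^N,\odot)$ are Abelian groups, where $\odot$ is the Hadamard (entrywise) product.
   Context: The set $\mathcal{C}_L^N$ of L-CoLT (lower-collinear triangular) matrices consists of all $M=[m_{i,j}]\in\mathbb{R}^{N\times N}$ with $m_{i,j}=0$ for $i<j$ and $m_{i+1,j}/m_{i,j}=r_i$ for $j\le i$ (with $i\le N-1$), for some vector $\boldsymbol{r}\in(\mathbb{R}\setminus\{0\})^{N-1}$. The set $\mathcal{C}_U^N$ of U-CoLT (upper-collinear triangular) matrices consists of all $M=[m_{i,j}]\in\mathbb{R}^{N\times N}$ with $m_{i,j}=0$ for $i\ge j$ and $m_{i-1,j}/m_{i,j}=r'_{i-1}$ for $i<j$ (with $i\ge2$), for some vector $\boldsymbol{r}'\in(\mathbb{R}\setminus\{0\})^{N-2}$.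
   Formalization: The matrices are additionally required to have nonzero triangle entries, i.e. m_{N,N}≠0 in C_L^N and m_{1,2}≠0 in C_U^N; these entries occur in no ratio, and if they may vanish the sets are not groups. *)

theory Defs
  imports "Jordan_Normal_Form.Matrix"
begin

text \<open>
  Rows and columns of matrices, and entries of vectors, are numbered from 0.  The index
  ranges below are therefore the usual one-based ones shifted by one.
\<close>

definition hadamard :: "real mat \<Rightarrow> real mat \<Rightarrow> real mat" (infixl "\<odot>" 70) where
  "A \<odot> B = mat (dim_row A) (dim_col A) (\<lambda>(i, j). A $$ (i, j) * B $$ (i, j))"

definition nonzero_vecs :: "nat \<Rightarrow> real vec set" where
  "nonzero_vecs n = {r \<in> carrier_vec n. \<forall>i<n. r $ i \<noteq> 0}"

text \<open>
  The ratio conditions with nonzero ratios already force the entries of the triangle to be nonzero,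
  with one exception each: the last diagonal entry in the lower case and the entry in the first row
  and second column in the upper case occur in no ratio.  The nonvanishing condition is stated for
  the whole triangle; its only effect is to exclude a zero in these two places, where a zero would
  have no inverse for the entrywise product.
\<close>

definition colt_L :: "nat \<Rightarrow> real mat set" where
  "colt_L N = {M \<in> carrier_mat N N.
     (\<forall>i j. i < j \<and> j < N \<longrightarrow> M $$ (i, j) = 0) \<and>
     (\<forall>i j. j \<le> i \<and> i < N \<longrightarrow> M $$ (i, j) \<noteq> 0) \<and>
     (\<exists>r \<in> nonzero_vecs (N - 1).
        \<forall>i j. j \<le> i \<and> Suc i < N \<longrightarrow> M $$ (Suc i, j) / M $$ (i, j) = r $ i)}"

definition colt_U :: "nat \<Rightarrow> real mat set" where
  "colt_U N = {M \<in> carrier_mat N N.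
     (\<forall>i j. j \<le> i \<and> i < N \<longrightarrow> M $$ (i, j) = 0) \<and>
     (\<forall>i j. i < j \<and> j < N \<longrightarrow> M $$ (i, j) \<noteq> 0) \<and>
     (\<exists>r \<in> nonzero_vecs (N - 2).
        \<forall>i j. Suc i < j \<and> j < N \<longrightarrow> M $$ (i, j) / M $$ (Suc i, j) = r $ i)}"

end

theory Submission
  imports Defs
begin

text \<open>
  Matrices with a prescribed set of nonzero positions form a group under the entrywise product: the
  unit is the indicator matrix of these positions, and inverses are entrywise because
  \<open>inverse 0 = 0\<close>.  Ratios of entries are multiplicative, so the collinearity conditions are
  preserved, the ratio vectors being multiplied and inverted entrywise.
\<close>

definition indicator_mat :: "nat \<Rightarrow> (nat \<Rightarrow> nat \<Rightarrow> bool) \<Rightarrow> real mat" where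
  "indicator_mat n T = mat n n (\<lambda>(i, j). if T i j then 1 else 0)"

text \<open>Treats both triangles at once: they differ only in the support \<open>T\<close>.
  Associativity and commutativity come entrywise from the reals, so only closure facts are left to
  the caller.\<close>

lemma hadamard_comm_group:
  assumes carr: "S \<subseteq> carrier_mat n n"
    and supp: "\<And>M i j. M \<in> S \<Longrightarrow> i < n \<Longrightarrow> j < n \<Longrightarrow> M $$ (i, j) \<noteq> 0 \<longleftrightarrow> T i j"
    and one: "indicator_mat n T \<in> S"
    and mult: "\<And>A B. A \<in> S \<Longrightarrow> B \<in> S \<Longrightarrow> A \<odot> B \<in> S"
    and inverse: "\<And>A. A \<in> S \<Longrightarrow> map_mat inverse A \<in> S"
  shows "comm_group \<lparr>carrier = S, mult = (\<odot>), one = indicator_mat n T\<rparr>"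
proof (rule comm_groupI, simp_all add: one mult)
  fix A B C assume "A \<in> S" "B \<in> S" "C \<in> S"
  then have "A \<in> carrier_mat n n" "B \<in> carrier_mat n n" "C \<in> carrier_mat n n"
    using carr by auto
  then show "A \<odot> B \<odot> C = A \<odot> (B \<odot> C)"
    by (intro eq_matI) (auto simp: hadamard_def)
next
  fix A B assume "A \<in> S" "B \<in> S"
  then have "A \<in> carrier_mat n n" "B \<in> carrier_mat n n"
    using carr by auto
  then show "A \<odot> B = B \<odot> A"
    by (intro eq_matI) (auto simp: hadamard_def)
next
  fix A assume A: "A \<in> S"
  then have dim: "A \<in> carrier_mat n n"
    using carr by auto
  \<comment> \<open>Off \<open>T\<close> the factor 0 is harmless, since \<open>supp\<close> makes
    the entry of \<open>A\<close> vanish there.\<close>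
  show "indicator_mat n T \<odot> A = A"
    using dim supp[OF A] by (intro eq_matI) (auto simp: hadamard_def indicator_mat_def)
  \<comment> \<open>Here the other direction of \<open>supp\<close> counts: entries on
    \<open>T\<close> are nonzero and cancel to 1, while off \<open>T\<close> the product is
    0.\<close>
  have "map_mat inverse A \<odot> A = indicator_mat n T"
    using dim supp[OF A] by (intro eq_matI) (auto simp: hadamard_def indicator_mat_def)
  then show "\<exists>B\<in>S. B \<odot> A = indicator_mat n T"
    using inverse[OF A] by blast
qed

lemma nonzero_vecs_one: "vec n (\<lambda>_. 1) \<in> nonzero_vecs n"
  by (simp add: nonzero_vecs_def)

lemma nonzero_vecs_mult:
  "r \<in> nonzero_vecs n \<Longrightarrow> s \<in> nonzero_vecs n \<Longrightarrow> vec n (\<lambda>i. r $ i * s $ i) \<in> nonzero_vecs n"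
  by (simp add: nonzero_vecs_def)

lemma nonzero_vecs_inverse:
  "r \<in> nonzero_vecs n \<Longrightarrow> vec n (\<lambda>i. inverse (r $ i)) \<in> nonzero_vecs n"
  by (simp add: nonzero_vecs_def)

text \<open>Both entries of every prescribed ratio lie in the triangle, so all ratios are 1 and the
  all-ones vector is a witness.\<close>

lemma indicator_mat_in_colt_L: "indicator_mat N (\<lambda>i j. j \<le> i) \<in> colt_L N"
  unfolding colt_L_def
  by (auto simp: indicator_mat_def intro!: bexI[OF _ nonzero_vecs_one])

lemma indicator_mat_in_colt_U: "indicator_mat N (\<lambda>i j. i < j) \<in> colt_U N"
  unfolding colt_U_def
  by (auto simp: indicator_mat_def intro!: bexI[OF _ nonzero_vecs_one])

text \<open>The quotient of two products is the product of the quotients, hence again independent of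
  the column. The zero pattern survives because the reals have no zero divisors.\<close>

lemma hadamard_in_colt_L:
  assumes A: "A \<in> colt_L N" and B: "B \<in> colt_L N"
  shows "A \<odot> B \<in> colt_L N"
proof -
  have dim: "A \<in> carrier_mat N N" "B \<in> carrier_mat N N"
    using A B by (simp_all add: colt_L_def)
  obtain r where r: "r \<in> nonzero_vecs (N - 1)"
      "\<And>i j. j \<le> i \<Longrightarrow> Suc i < N \<Longrightarrow> A $$ (Suc i, j) / A $$ (i, j) = r $ i"
    using A by (auto simp: colt_L_def)
  obtain s where s: "s \<in> nonzero_vecs (N - 1)"
      "\<And>i j. j \<le> i \<Longrightarrow> Suc i < N \<Longrightarrow> B $$ (Suc i, j) / B $$ (i, j) = s $ i"
    using B by (auto simp: colt_L_def)
  \<comment> \<open>The witness is the entrywise product of the two ratio vectors;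
    \<open>Suc i < N\<close> keeps \<open>i\<close> below its length \<open>N - 1\<close>.\<close>
  have "(A \<odot> B) $$ (Suc i, j) / (A \<odot> B) $$ (i, j) = vec (N - 1) (\<lambda>i. r $ i * s $ i) $ i"
    if "j \<le> i" "Suc i < N" for i j
  proof -
    have "(A \<odot> B) $$ (Suc i, j) / (A \<odot> B) $$ (i, j) = A $$ (Suc i, j) / A $$ (i, j) * (B $$ (Suc i, j) / B $$ (i, j))"
      using that dim by (simp add: hadamard_def)
    also have "\<dots> = r $ i * s $ i"
      by (simp only: r(2)[OF that] s(2)[OF that])
    finally show ?thesis
      using that by simp
  qed
  then have "\<exists>t\<in>nonzero_vecs (N - 1). \<forall>i j. j \<le> i \<and> Suc i < N \<longrightarrow>
      (A \<odot> B) $$ (Suc i, j) / (A \<odot> B) $$ (i, j) = t $ i"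
    by (intro bexI[OF _ nonzero_vecs_mult[OF r(1) s(1)]]) blast
  moreover have "(A \<odot> B) $$ (i, j) = 0" if "i < j" "j < N" for i j
    using that dim A B by (simp add: colt_L_def hadamard_def)
  moreover have "(A \<odot> B) $$ (i, j) \<noteq> 0" if "j \<le> i" "i < N" for i j
    using that dim A B by (simp add: colt_L_def hadamard_def)
  moreover have "A \<odot> B \<in> carrier_mat N N"
    using dim by (simp add: hadamard_def)
  ultimately show ?thesis
    by (simp add: colt_L_def)
qed

lemma hadamard_in_colt_U:
  assumes A: "A \<in> colt_U N" and B: "B \<in> colt_U N"
  shows "A \<odot> B \<in> colt_U N"
proof -
  have dim: "A \<in> carrier_mat N N" "B \<in> carrier_mat N N"
    using A B by (simp_all add: colt_U_def)
  obtain r where r: "r \<in> nonzero_vecs (N - 2)"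
      "\<And>i j. Suc i < j \<Longrightarrow> j < N \<Longrightarrow> A $$ (i, j) / A $$ (Suc i, j) = r $ i"
    using A by (auto simp: colt_U_def)
  obtain s where s: "s \<in> nonzero_vecs (N - 2)"
      "\<And>i j. Suc i < j \<Longrightarrow> j < N \<Longrightarrow> B $$ (i, j) / B $$ (Suc i, j) = s $ i"
    using B by (auto simp: colt_U_def)
  \<comment> \<open>Both rows of a ratio must lie strictly above the diagonal:
    \<open>Suc i < j\<close> and \<open>j < N\<close> give \<open>i < N - 2\<close>, the length of
    the ratio vector.\<close>
  have "(A \<odot> B) $$ (i, j) / (A \<odot> B) $$ (Suc i, j) = vec (N - 2) (\<lambda>i. r $ i * s $ i) $ i"
    if "Suc i < j" "j < N" for i j
  proof -
    have "(A \<odot> B) $$ (i, j) / (A \<odot> B) $$ (Suc i, j) = A $$ (i, j) / A $$ (Suc i, j) * (B $$ (i, j) / B $$ (Suc i, j))"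
      using that dim by (simp add: hadamard_def)
    also have "\<dots> = r $ i * s $ i"
      by (simp only: r(2)[OF that] s(2)[OF that])
    finally show ?thesis
      using that by simp
  qed
  then have "\<exists>t\<in>nonzero_vecs (N - 2). \<forall>i j. Suc i < j \<and> j < N \<longrightarrow>
      (A \<odot> B) $$ (i, j) / (A \<odot> B) $$ (Suc i, j) = t $ i"
    by (intro bexI[OF _ nonzero_vecs_mult[OF r(1) s(1)]]) blast
  moreover have "(A \<odot> B) $$ (i, j) = 0" if "j \<le> i" "i < N" for i j
    using that dim A B by (simp add: colt_U_def hadamard_def)
  moreover have "(A \<odot> B) $$ (i, j) \<noteq> 0" if "i < j" "j < N" for i j
    using that dim A B by (simp add: colt_U_def hadamard_def)
  moreover have "A \<odot> B \<in> carrier_mat N N"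
    using dim by (simp add: hadamard_def)
  ultimately show ?thesis
    by (simp add: colt_U_def)
qed

text \<open>Inversion commutes with quotients, so each ratio is replaced by its reciprocal, which is
  again nonzero.\<close>

lemma map_mat_inverse_in_colt_L:
  assumes A: "A \<in> colt_L N"
  shows "map_mat inverse A \<in> colt_L N"
proof -
  have dim: "A \<in> carrier_mat N N"
    using A by (simp add: colt_L_def)
  obtain r where r: "r \<in> nonzero_vecs (N - 1)"
      "\<And>i j. j \<le> i \<Longrightarrow> Suc i < N \<Longrightarrow> A $$ (Suc i, j) / A $$ (i, j) = r $ i"
    using A by (auto simp: colt_L_def)
  have "map_mat inverse A $$ (Suc i, j) / map_mat inverse A $$ (i, j) = vec (N - 1) (\<lambda>i. inverse (r $ i)) $ i"
    if "j \<le> i" "Suc i < N" for i j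
  proof -
    have "map_mat inverse A $$ (Suc i, j) / map_mat inverse A $$ (i, j) = inverse (A $$ (Suc i, j) / A $$ (i, j))"
      using that dim by (simp add: divide_inverse mult.commute)
    also have "\<dots> = inverse (r $ i)"
      by (simp only: r(2)[OF that])
    finally show ?thesis
      using that by simp
  qed
  then have "\<exists>t\<in>nonzero_vecs (N - 1). \<forall>i j. j \<le> i \<and> Suc i < N \<longrightarrow>
      map_mat inverse A $$ (Suc i, j) / map_mat inverse A $$ (i, j) = t $ i"
    by (intro bexI[OF _ nonzero_vecs_inverse[OF r(1)]]) blast
  \<comment> \<open>Zeros outside the triangle persist by the convention
    \<open>inverse 0 = 0\<close>.\<close>
  moreover have "map_mat inverse A $$ (i, j) = 0" if "i < j" "j < N" for i j
    using that dim A by (simp add: colt_L_def)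
  \<comment> \<open>This covers the last diagonal entry, which no ratio controls; it is nonzero by
    the nonvanishing clause of \<open>colt_L\<close>.\<close>
  moreover have "map_mat inverse A $$ (i, j) \<noteq> 0" if "j \<le> i" "i < N" for i j
    using that dim A by (simp add: colt_L_def)
  moreover have "map_mat inverse A \<in> carrier_mat N N"
    using dim by (simp)
  ultimately show ?thesis
    by (simp add: colt_L_def)
qed

lemma map_mat_inverse_in_colt_U:
  assumes A: "A \<in> colt_U N"
  shows "map_mat inverse A \<in> colt_U N"
proof -
  have dim: "A \<in> carrier_mat N N"
    using A by (simp add: colt_U_def)
  obtain r where r: "r \<in> nonzero_vecs (N - 2)"
      "\<And>i j. Suc i < j \<Longrightarrow> j < N \<Longrightarrow> A $$ (i, j) / A $$ (Suc i, j) = r $ i"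
    using A by (auto simp: colt_U_def)
  have "map_mat inverse A $$ (i, j) / map_mat inverse A $$ (Suc i, j) = vec (N - 2) (\<lambda>i. inverse (r $ i)) $ i"
    if "Suc i < j" "j < N" for i j
  proof -
    have "map_mat inverse A $$ (i, j) / map_mat inverse A $$ (Suc i, j) = inverse (A $$ (i, j) / A $$ (Suc i, j))"
      using that dim by (simp add: divide_inverse mult.commute)
    also have "\<dots> = inverse (r $ i)"
      by (simp only: r(2)[OF that])
    finally show ?thesis
      using that by simp
  qed
  then have "\<exists>t\<in>nonzero_vecs (N - 2). \<forall>i j. Suc i < j \<and> j < N \<longrightarrow>
      map_mat inverse A $$ (i, j) / map_mat inverse A $$ (Suc i, j) = t $ i"
    by (intro bexI[OF _ nonzero_vecs_inverse[OF r(1)]]) blast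
  moreover have "map_mat inverse A $$ (i, j) = 0" if "j \<le> i" "i < N" for i j
    using that dim A by (simp add: colt_U_def)
  \<comment> \<open>For the entry at \<open>(0, 1)\<close>, which lies in no ratio, this rests on
    the nonvanishing clause of \<open>colt_U\<close>.\<close>
  moreover have "map_mat inverse A $$ (i, j) \<noteq> 0" if "i < j" "j < N" for i j
    using that dim A by (simp add: colt_U_def)
  moreover have "map_mat inverse A \<in> carrier_mat N N"
    using dim by (simp)
  ultimately show ?thesis
    by (simp add: colt_U_def)
qed

theorem theorem3p4:
  fixes N :: nat
  shows "(\<exists>e. comm_group \<lparr>carrier = colt_L N, mult = (\<odot>), one = e\<rparr>) \<and>
         (\<exists>e. comm_group \<lparr>carrier = colt_U N, mult = (\<odot>), one = e\<rparr>)"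
proof (intro conjI exI)
  \<comment> \<open>The unit is the 0/1 matrix of the closed lower triangle, not the all-ones
    matrix, which for \<open>N\<close> at least 2 lies outside \<open>colt_L N\<close>.\<close>
  show "comm_group \<lparr>carrier = colt_L N, mult = (\<odot>), one = indicator_mat N (\<lambda>i j. j \<le> i)\<rparr>"
  proof (rule hadamard_comm_group)
    show "colt_L N \<subseteq> carrier_mat N N"
      by (auto simp: colt_L_def)
    show "M $$ (i, j) \<noteq> 0 \<longleftrightarrow> j \<le> i" if "M \<in> colt_L N" "i < N" "j < N" for M i j
      using that unfolding colt_L_def by (cases "j \<le> i") auto
  qed (fact indicator_mat_in_colt_L hadamard_in_colt_L map_mat_inverse_in_colt_L)+
  \<comment> \<open>Here the support is the strict upper triangle, so the unit has a zero
    diagonal.\<close>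
  show "comm_group \<lparr>carrier = colt_U N, mult = (\<odot>), one = indicator_mat N (\<lambda>i j. i < j)\<rparr>"
  proof (rule hadamard_comm_group)
    show "colt_U N \<subseteq> carrier_mat N N"
      by (auto simp: colt_U_def)
    show "M $$ (i, j) \<noteq> 0 \<longleftrightarrow> i < j" if "M \<in> colt_U N" "i < N" "j < N" for M i j
      using that unfolding colt_U_def by (cases "i < j") auto
  qed (fact indicator_mat_in_colt_U hadamard_in_colt_U map_mat_inverse_in_colt_U)+
qed

end
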